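(* Let $k\ge 1$ be an integer, let $G$ be a connected triangle-free graph, and let $v\in V(G)$. If $G$ contains no induced subgraph on $k+1$ vertices that is a tree containing $v$, then $|V(G)\setminus N[v]|\le \frac{(k-2)(k-1)}{2}$.
   Context: All graphs are simple and finite. $N[v]$ denotes the closed neighborhood of $v$, i.e. $v$ together with all vertices adjacent to $v$. *)

theory Defs
  imports Complex_Main
begin

definition simple_graph :: "'a set \<Rightarrow> ('a \<Rightarrow> 'a \<Rightarrow> bool) \<Rightarrow> bool" where
  "simple_graph V E \<longleftrightarrow> finite V \<and> (\<forall>x y. E x y \<longrightarrow> x \<in> V \<and> y \<in> V)
     \<and> (\<forall>x y. E x y \<longrightarrow> E y x) \<and> (\<forall>x. \<not> E x x)"

definition walk_in :: "('a \<Rightarrow> 'a \<Rightarrow> bool) \<Rightarrow> 'a set \<Rightarrow> 'a list \<Rightarrow> bool" where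
  "walk_in E S p \<longleftrightarrow> p \<noteq> [] \<and> set p \<subseteq> S \<and> (\<forall>i. Suc i < length p \<longrightarrow> E (p ! i) (p ! Suc i))"

definition connected_on :: "('a \<Rightarrow> 'a \<Rightarrow> bool) \<Rightarrow> 'a set \<Rightarrow> bool" where
  "connected_on E S \<longleftrightarrow> S \<noteq> {} \<and>
     (\<forall>x\<in>S. \<forall>y\<in>S. \<exists>p. walk_in E S p \<and> hd p = x \<and> last p = y)"

definition has_cycle_on :: "('a \<Rightarrow> 'a \<Rightarrow> bool) \<Rightarrow> 'a set \<Rightarrow> bool" where
  "has_cycle_on E S \<longleftrightarrow> (\<exists>c. length c \<ge> 3 \<and> distinct c \<and> walk_in E S c \<and> E (last c) (hd c))"

definition induced_tree :: "('a \<Rightarrow> 'a \<Rightarrow> bool) \<Rightarrow> 'a set \<Rightarrow> bool" where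
  "induced_tree E S \<longleftrightarrow> connected_on E S \<and> \<not> has_cycle_on E S"

definition triangle_free :: "('a \<Rightarrow> 'a \<Rightarrow> bool) \<Rightarrow> bool" where
  "triangle_free E \<longleftrightarrow> (\<forall>x y z. \<not> (E x y \<and> E y z \<and> E x z))"

definition closed_nbhd :: "'a set \<Rightarrow> ('a \<Rightarrow> 'a \<Rightarrow> bool) \<Rightarrow> 'a \<Rightarrow> 'a set" where
  "closed_nbhd V E v = insert v {u \<in> V. E v u}"

end

theory Submission
  imports Defs
begin

text \<open>
  Let \<open>D\<close> range over the components of \<open>G - N[v]\<close> and let \<open>t\<^sub>D\<close> be least with
  \<open>|D| \<le> t\<^sub>D (t\<^sub>D + 1) / 2\<close>. By induction on the number of vertices, every neighbour \<open>u\<close> of \<open>v\<close>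
  that touches \<open>D\<close> is the root of an induced tree in \<open>D \<union> {u}\<close> with \<open>t\<^sub>D\<close> further vertices. Gluing
  such trees shows, for every set \<open>I\<close> of neighbours of \<open>v\<close>, that \<open>1 + |I|\<close> plus the sum of \<open>t\<^sub>D\<close>
  over those \<open>D\<close> touched by exactly one member of \<open>I\<close> is at most \<open>k\<close>.

  It remains to deduce \<open>\<Sum> t\<^sub>D (t\<^sub>D + 1) \<le> (k - 1) (k - 2)\<close>. Give \<open>D\<close> a supply of \<open>t\<^sub>D\<close> tokens.
  Repeatedly shrink \<open>I\<close> to a minimal set touching all \<open>D\<close> that still have tokens, and for every
  \<open>i \<in> I\<close> remove one token from some \<open>D\<close> touched only by \<open>i\<close>. In each round the weights
  \<open>t\<^sub>D + 1\<close> of the removed tokens sum to at most \<open>k - 1\<close>, and each surviving \<open>i\<close> touches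
  at least one token less than before. As each \<open>i\<close> touches at most \<open>k - 2\<close> tokens initially,
  there are at most \<open>k - 2\<close> rounds.
\<close>

section \<open>The token argument\<close>

lemma minimal_cover_private:
  assumes "finite U" and cover: "\<forall>D\<in>F. \<exists>i\<in>U. A D i"
  obtains U' p where "U' \<subseteq> U" "\<forall>D\<in>F. \<exists>i\<in>U'. A D i"
    "\<forall>i\<in>U'. p i \<in> F \<and> A (p i) i \<and> (\<forall>j\<in>U'. A (p i) j \<longrightarrow> j = i)"
proof -
  let ?C = "\<lambda>W. W \<subseteq> U \<and> (\<forall>D\<in>F. \<exists>i\<in>W. A D i)"
  have "?C U" using cover by blast
  then obtain U' where U': "?C U'" and least: "\<And>W. ?C W \<Longrightarrow> card U' \<le> card W"
    using ex_has_least_nat[of ?C U card] by blast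
  have fin: "finite U'" using U' \<open>finite U\<close> finite_subset by blast
  have "\<exists>D. D \<in> F \<and> A D i \<and> (\<forall>j\<in>U'. A D j \<longrightarrow> j = i)" if "i \<in> U'" for i
  proof -
    have "card (U' - {i}) < card U'" using fin that by (rule card_Diff1_less)
    then have "\<not> ?C (U' - {i})" using least[of "U' - {i}"] by linarith
    then show ?thesis using U' by blast
  qed
  then have "\<forall>i\<in>U'. \<exists>D. D \<in> F \<and> A D i \<and> (\<forall>j\<in>U'. A D j \<longrightarrow> j = i)" by blast
  from bchoice[OF this] show thesis using that U' by blast
qed

text \<open>Here \<open>r\<close> counts the tokens left while the weights \<open>t\<close> stay
  fixed, so that the induction can lower \<open>r\<close> and keep the last hypothesis intact. Each
  round removes tokens of total weight at most \<open>K\<close> and lowers \<open>s\<close>, the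
  bound on the tokens touched by a single \<open>i\<close>.\<close>

lemma token_removal_bound:
  fixes t r :: "'d \<Rightarrow> nat" and A :: "'d \<Rightarrow> 'i \<Rightarrow> bool"
  assumes "finite F" and "finite U"
    and "\<forall>D\<in>F. r D > 0 \<longrightarrow> (\<exists>i\<in>U. A D i)"
    and "\<forall>i\<in>U. (\<Sum>D | D \<in> F \<and> A D i. r D) \<le> s"
    and "\<forall>I\<subseteq>U. card I + (\<Sum>D | D \<in> F \<and> (\<exists>!i. i \<in> I \<and> A D i). t D) \<le> K"
  shows "(\<Sum>D\<in>F. r D * (t D + 1)) \<le> K * s"
  using assms(2-)
proof (induction s arbitrary: r U)
  case 0
  have "r D = 0" if D: "D \<in> F" for D
  proof (rule ccontr)
    assume "r D \<noteq> 0"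
    then have "r D > 0" by simp
    then obtain i where i: "i \<in> U" "A D i" using 0(2) D by blast
    then have "(\<Sum>D | D \<in> F \<and> A D i. r D) = 0" using 0 by auto
    then show False using \<open>finite F\<close> i D \<open>r D \<noteq> 0\<close> by auto
  qed
  then show ?case by simp
next
  case (Suc s)
  have cov0: "\<forall>D\<in>{D \<in> F. r D > 0}. \<exists>i\<in>U. A D i" using Suc.prems(2) by blast
  obtain U' p where U': "U' \<subseteq> U" and cov: "\<forall>D\<in>{D \<in> F. r D > 0}. \<exists>i\<in>U'. A D i"
    and p: "\<forall>i\<in>U'. p i \<in> {D \<in> F. r D > 0} \<and> A (p i) i \<and> (\<forall>j\<in>U'. A (p i) j \<longrightarrow> j = i)"
    by (rule minimal_cover_private[OF Suc.prems(1) cov0])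
  have finU': "finite U'" using U' Suc.prems(1) finite_subset by blast
  define P where "P = p ` U'"
  have PF: "P \<subseteq> F" using p by (auto simp: P_def)
  have "inj_on p U'" by (intro inj_onI) (metis p)
  then have cardP: "card P = card U'" by (simp add: P_def card_image)
  define r' where "r' D = (if D \<in> P then r D - 1 else r D)" for D
  have rpos: "r D > 0" if "D \<in> P" for D using that p by (auto simp: P_def)
  have split: "r D = r' D + (if D \<in> P then 1 else 0)" for D
    using rpos[of D] by (auto simp: r'_def)
  have "(\<Sum>D\<in>F. r' D * (t D + 1)) \<le> K * s"
  proof (rule Suc.IH)
    show "finite U'" by (rule finU')
    show "\<forall>D\<in>F. r' D > 0 \<longrightarrow> (\<exists>i\<in>U'. A D i)"
      using cov by (auto simp: r'_def split: if_splits)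
    show "\<forall>I\<subseteq>U'. card I + (\<Sum>D | D \<in> F \<and> (\<exists>!i. i \<in> I \<and> A D i). t D) \<le> K"
      by (intro allI impI Suc.prems(4)[rule_format] subset_trans[OF _ U'])
    show "\<forall>i\<in>U'. (\<Sum>D | D \<in> F \<and> A D i. r' D) \<le> s"
    proof
      fix i assume i: "i \<in> U'"
      \<comment> \<open>The set \<open>p i\<close> is touched by \<open>i\<close> and has just lost
        a token, so every surviving \<open>i\<close> touches strictly fewer tokens.\<close>
      have "(\<Sum>D | D \<in> F \<and> A D i. r' D) < (\<Sum>D | D \<in> F \<and> A D i. r D)"
      proof (rule sum_strict_mono_ex1)
        have "p i \<in> {D \<in> F. A D i}" "r' (p i) < r (p i)"
          using bspec[OF p i] i by (auto simp: r'_def P_def)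
        then show "\<exists>D\<in>{D \<in> F. A D i}. r' D < r D" by blast
      qed (use \<open>finite F\<close> in \<open>auto simp: r'_def\<close>)
      moreover have "(\<Sum>D | D \<in> F \<and> A D i. r D) \<le> Suc s" using Suc.prems(3) U' i by blast
      ultimately show "(\<Sum>D | D \<in> F \<and> A D i. r' D) \<le> s" by linarith
    qed
  qed
  \<comment> \<open>Instance \<open>I = U'\<close> of the last hypothesis: each member of
    \<open>P\<close> is touched by exactly one element of \<open>U'\<close>, and
    \<open>card U'\<close> pays for the summands 1.\<close>
  moreover have "(\<Sum>D\<in>P. t D + 1) \<le> K"
  proof -
    have "(\<Sum>D\<in>P. t D) \<le> (\<Sum>D | D \<in> F \<and> (\<exists>!i. i \<in> U' \<and> A D i). t D)"
    proof (rule sum_mono2)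
      show "P \<subseteq> {D \<in> F. \<exists>!i. i \<in> U' \<and> A D i}"
        using p unfolding P_def by blast
    qed (use \<open>finite F\<close> in auto)
    then have "card U' + (\<Sum>D\<in>P. t D) \<le> K"
      using Suc.prems(4)[rule_format, OF U'] by linarith
    then show ?thesis unfolding sum.distrib using cardP by simp
  qed
  moreover have "(\<Sum>D\<in>F. r D * (t D + 1)) = (\<Sum>D\<in>F. r' D * (t D + 1)) + (\<Sum>D\<in>P. t D + 1)"
  proof -
    have "(\<Sum>D\<in>F. r D * (t D + 1))
        = (\<Sum>D\<in>F. r' D * (t D + 1) + (if D \<in> P then t D + 1 else 0))"
    proof (rule sum.cong[OF refl])
      fix D
      show "r D * (t D + 1) = r' D * (t D + 1) + (if D \<in> P then t D + 1 else 0)"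
        unfolding split[of D] by (simp add: distrib_right)
    qed
    also have "\<dots> = (\<Sum>D\<in>F. r' D * (t D + 1)) + (\<Sum>D\<in>F. if D \<in> P then t D + 1 else 0)"
      by (rule sum.distrib)
    also have "(\<Sum>D\<in>F. if D \<in> P then t D + 1 else 0) = (\<Sum>D\<in>P. t D + 1)"
      using sum.inter_restrict[OF \<open>finite F\<close>, of "\<lambda>D. t D + 1" P] PF by (simp add: Int_absorb1)
    finally show ?thesis .
  qed
  ultimately show ?case by simp
qed

text \<open>Start the token removal with \<open>r = t\<close>. The singletons \<open>I = {i}\<close>
  in \<open>unique\<close> give \<open>s = K - 1\<close>.\<close>

lemma unique_cover_quadratic_bound:
  fixes t :: "'d \<Rightarrow> nat" and A :: "'d \<Rightarrow> 'i \<Rightarrow> bool"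
  assumes "finite F" and "finite U"
    and cover: "\<forall>D\<in>F. \<exists>i\<in>U. A D i"
    and unique: "\<forall>I\<subseteq>U. card I + (\<Sum>D | D \<in> F \<and> (\<exists>!i. i \<in> I \<and> A D i). t D) \<le> K"
  shows "(\<Sum>D\<in>F. t D * (t D + 1)) \<le> K * (K - 1)"
proof (rule token_removal_bound[OF assms(1,2) _ _ unique])
  show "\<forall>D\<in>F. t D > 0 \<longrightarrow> (\<exists>i\<in>U. A D i)" using cover by blast
  show "\<forall>i\<in>U. (\<Sum>D | D \<in> F \<and> A D i. t D) \<le> K - 1"
  proof
    fix i assume "i \<in> U"
    then have "card {i} + (\<Sum>D | D \<in> F \<and> (\<exists>!j. j \<in> {i} \<and> A D j). t D) \<le> K"
      using unique by blast
    moreover have "{D. D \<in> F \<and> (\<exists>!j. j \<in> {i} \<and> A D j)} = {D. D \<in> F \<and> A D i}" by auto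
    ultimately show "(\<Sum>D | D \<in> F \<and> A D i. t D) \<le> K - 1" by simp
  qed
qed

section \<open>Rooted induced trees\<close>

text \<open>Attaching leaves one at a time, each with exactly one neighbour so far, provides an
  induction suited to pruning and gluing, which connectedness plus acyclicity would not offer
  directly.\<close>

inductive rooted_tree :: "('a \<Rightarrow> 'a \<Rightarrow> bool) \<Rightarrow> 'a \<Rightarrow> 'a set \<Rightarrow> bool" for E r where
  root: "rooted_tree E r {r}"
| leaf: "rooted_tree E r S \<Longrightarrow> x \<notin> S \<Longrightarrow> \<exists>!y. y \<in> S \<and> E y x \<Longrightarrow> rooted_tree E r (insert x S)"

lemma rooted_tree_root: "rooted_tree E r S \<Longrightarrow> r \<in> S"
  by (induction rule: rooted_tree.induct) auto

lemma rooted_tree_finite: "rooted_tree E r S \<Longrightarrow> finite S"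
  by (induction rule: rooted_tree.induct) auto

text \<open>Stop the leaf-by-leaf construction after \<open>j\<close> vertices.\<close>

lemma rooted_tree_subtree:
  assumes "rooted_tree E r S" "1 \<le> j" "j \<le> card S"
  shows "\<exists>T\<subseteq>S. rooted_tree E r T \<and> card T = j"
  using assms
proof (induction rule: rooted_tree.induct)
  case root
  then show ?case by (auto intro!: exI[of _ "{r}"] rooted_tree.root)
next
  case (leaf S x)
  show ?case
  proof (cases "j \<le> card S")
    case True
    then show ?thesis using leaf by blast
  next
    case False
    then have "j = card (insert x S)"
      using leaf rooted_tree_finite[OF leaf.hyps(1)] by simp
    then show ?thesis using rooted_tree.leaf[OF leaf.hyps] by blast
  qed
qed

text \<open>Replay the construction of \<open>T\<close> on top of \<open>S\<close>: the common
  vertex \<open>u\<close> is the only one in \<open>S\<close> that can be adjacent to a new leaf, so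
  each leaf keeps its unique neighbour.\<close>

lemma rooted_tree_glue:
  assumes "rooted_tree E u T" "rooted_tree E r S" "u \<in> S" "S \<inter> T \<subseteq> {u}"
    "\<forall>a\<in>S - {u}. \<forall>b\<in>T - {u}. \<not> E a b"
  shows "rooted_tree E r (S \<union> T)"
  using assms
proof (induction rule: rooted_tree.induct)
  case root
  then show ?case by (simp add: insert_absorb)
next
  case (leaf T x)
  have u: "u \<in> T" using leaf.hyps(1) by (rule rooted_tree_root)
  then have "x \<noteq> u" using leaf.hyps by blast
  have "rooted_tree E r (insert x (S \<union> T))"
  proof (rule rooted_tree.leaf)
    show "rooted_tree E r (S \<union> T)" using leaf by blast
    show "x \<notin> S \<union> T" using leaf \<open>x \<noteq> u\<close> by blast
    obtain y where y: "y \<in> T" "E y x" "\<And>z. z \<in> T \<Longrightarrow> E z x \<Longrightarrow> z = y" using leaf.hyps by blast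
    have "z \<in> T" if "z \<in> S" "E z x" for z
      using leaf.prems that \<open>x \<noteq> u\<close> u by blast
    then show "\<exists>!y. y \<in> S \<union> T \<and> E y x" using y by blast
  qed
  then show ?case by simp
qed

lemma rooted_tree_star:
  assumes "finite N" "r \<notin> N" "\<forall>x\<in>N. E r x" "\<forall>x\<in>N. \<forall>y\<in>N. \<not> E x y"
  shows "rooted_tree E r (insert r N)"
  using assms
proof (induction rule: finite_induct)
  case empty
  then show ?case by (simp add: rooted_tree.root)
next
  case (insert x N)
  have "rooted_tree E r (insert x (insert r N))"
    by (rule rooted_tree.leaf) (use insert in auto)
  then show ?case by (simp add: insert_commute)
qed

section \<open>Connectedness and acyclicity of rooted trees\<close>

lemma connected_on_insert:
  assumes S: "connected_on E S" and y: "y \<in> S" "E y x" "E x y"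
  shows "connected_on E (insert x S)"
proof -
  have mono: "walk_in E (insert x S) p" if "walk_in E S p" for p
    using that by (auto simp: walk_in_def)
  have out: "\<exists>p. walk_in E (insert x S) p \<and> hd p = x \<and> last p = b" if b: "b \<in> S" for b
  proof -
    obtain p where p: "walk_in E S p" "hd p = y" "last p = b"
      using S y b unfolding connected_on_def by blast
    then have "walk_in E (insert x S) (x # p)"
      using y by (auto simp: walk_in_def nth_Cons hd_conv_nth split: nat.splits)
    then show ?thesis using p by (intro exI[of _ "x # p"]) (auto simp: walk_in_def)
  qed
  have into: "\<exists>p. walk_in E (insert x S) p \<and> hd p = a \<and> last p = x" if a: "a \<in> S" for a
  proof -
    obtain p where p: "walk_in E S p" "hd p = a" "last p = y"
      using S y a unfolding connected_on_def by blast
    have "E ((p @ [x]) ! i) ((p @ [x]) ! Suc i)" if "Suc i < length (p @ [x])" for i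
    proof (cases "Suc i < length p")
      case True
      then show ?thesis using p by (auto simp: walk_in_def nth_append)
    next
      case False
      then have "Suc i = length p" using that by simp
      then have "p ! i = y" "i < length p"
        using p last_conv_nth[of p] by (auto simp: walk_in_def simp flip: \<open>Suc i = length p\<close>)
      then show ?thesis using y \<open>Suc i = length p\<close> by (simp add: nth_append)
    qed
    then have "walk_in E (insert x S) (p @ [x])" using p by (auto simp: walk_in_def)
    then show ?thesis using p by (intro exI[of _ "p @ [x]"]) (auto simp: walk_in_def)
  qed
  have self: "\<exists>p. walk_in E (insert x S) p \<and> hd p = x \<and> last p = x"
    by (intro exI[of _ "[x]"]) (auto simp: walk_in_def)
  have "\<exists>p. walk_in E (insert x S) p \<and> hd p = a \<and> last p = b"
    if ab: "a \<in> insert x S" "b \<in> insert x S" for a b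
  proof (cases "a = x \<or> b = x")
    case True
    then show ?thesis using that out into self by blast
  next
    case False
    then obtain p where "walk_in E S p" "hd p = a" "last p = b"
      using S ab unfolding connected_on_def by blast
    then show ?thesis using mono by blast
  qed
  then show ?thesis by (auto simp: connected_on_def)
qed

text \<open>A cycle avoiding \<open>x\<close> lies in \<open>S\<close>; a cycle through
  \<open>x\<close> yields two different neighbours of \<open>x\<close> in \<open>S\<close>.\<close>

lemma no_cycle_insert_leaf:
  assumes sym: "\<And>a b. E a b \<Longrightarrow> E b a" and irrefl: "\<And>a. \<not> E a a"
    and S: "\<not> has_cycle_on E S" and leaf: "\<exists>!y. y \<in> S \<and> E y x"
  shows "\<not> has_cycle_on E (insert x S)"
proof
  assume "has_cycle_on E (insert x S)"
  then obtain c where c: "length c \<ge> 3" "distinct c" "walk_in E (insert x S) c" "E (last c) (hd c)"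
    by (auto simp: has_cycle_on_def)
  have sub: "set c \<subseteq> insert x S" and step: "\<And>i. Suc i < length c \<Longrightarrow> E (c ! i) (c ! Suc i)"
    using c by (auto simp: walk_in_def)
  have wrap: "E (c ! (length c - 1)) (c ! 0)"
    using c by (metis hd_conv_nth last_conv_nth list.size(3) not_numeral_le_zero)
  have uniq: "c ! a = c ! b" if "a < length c" "b < length c" "E (c ! a) x" "E (c ! b) x" for a b
  proof -
    have "c ! a \<in> insert x S" "c ! b \<in> insert x S" using that sub nth_mem by blast+
    then have "c ! a \<in> S" "c ! b \<in> S" using that irrefl by auto
    then show ?thesis using that leaf by blast
  qed
  have "x \<in> set c"
  proof (rule ccontr)
    assume "x \<notin> set c"
    then have "walk_in E S c" using c by (auto simp: walk_in_def)
    then show False using S c by (auto simp: has_cycle_on_def)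
  qed
  then obtain i where i: "i < length c" "c ! i = x" by (auto simp: in_set_conv_nth)
  obtain a b where ab: "a < length c" "b < length c" "a \<noteq> b" "E (c ! a) x" "E (c ! b) x"
  proof -
    let ?n = "length c"
    \<comment> \<open>The indices \<open>a\<close> and \<open>b\<close> are the cyclic predecessor
      and successor of \<open>i\<close>; length at least 3 makes them distinct.\<close>
    define a where "a = (if i = 0 then ?n - 1 else i - 1)"
    define b where "b = (if Suc i < ?n then Suc i else 0)"
    have "a < ?n" "b < ?n" "a \<noteq> b" using i c(1) by (auto simp: a_def b_def)
    moreover have "E (c ! a) x" using wrap step[of "i - 1"] i by (cases i) (auto simp: a_def)
    moreover have "E x (c ! b)"
    proof (cases "Suc i < ?n")
      case True
      then show ?thesis using step[of i] i by (simp add: b_def)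
    next
      case False
      then have "i = ?n - 1" using i by linarith
      then show ?thesis using wrap i False by (simp add: b_def)
    qed
    ultimately show thesis using that sym by blast
  qed
  then show False using uniq[of a b] c(2) by (simp add: nth_eq_iff_index_eq)
qed

lemma rooted_tree_induced_tree:
  assumes sym: "\<And>a b. E a b \<Longrightarrow> E b a" and irrefl: "\<And>a. \<not> E a a"
    and "rooted_tree E r S"
  shows "induced_tree E S"
  using assms(3)
proof (induction rule: rooted_tree.induct)
  case root
  have "connected_on E {r}" unfolding connected_on_def
    by (auto simp: walk_in_def intro!: exI[of _ "[r]"])
  moreover have "\<not> has_cycle_on E {r}"
  proof
    assume "has_cycle_on E {r}"
    then obtain c where c: "length c \<ge> 3" "distinct c" "set c \<subseteq> {r}"
      by (auto simp: has_cycle_on_def walk_in_def)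
    then show False using card_mono[of "{r}" "set c"] by (simp add: distinct_card)
  qed
  ultimately show ?case by (simp add: induced_tree_def)
next
  case (leaf S x)
  then obtain y where "y \<in> S" "E y x" by blast
  then show ?case
    using leaf connected_on_insert[of E S y x] no_cycle_insert_leaf[of E S x, OF sym irrefl] sym
    by (auto simp: induced_tree_def)
qed

section \<open>Components outside the neighbourhood of the root\<close>

text \<open>Reflexivity holds even for vertices outside \<open>S\<close>, hence the separate
  assumption \<open>x \<in> S\<close> in facts such as \<open>component_subset\<close>.\<close>

definition reach :: "('a \<Rightarrow> 'a \<Rightarrow> bool) \<Rightarrow> 'a set \<Rightarrow> 'a \<Rightarrow> 'a \<Rightarrow> bool" where
  "reach E S = (\<lambda>a b. E a b \<and> a \<in> S \<and> b \<in> S)\<^sup>*\<^sup>*"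

definition component :: "('a \<Rightarrow> 'a \<Rightarrow> bool) \<Rightarrow> 'a set \<Rightarrow> 'a \<Rightarrow> 'a set" where
  "component E S x = {y. reach E S x y}"

lemma reach_refl: "reach E S x x"
  by (simp add: reach_def)

lemma reach_edge: "E x y \<Longrightarrow> x \<in> S \<Longrightarrow> y \<in> S \<Longrightarrow> reach E S x y"
  by (auto simp: reach_def)

lemma reach_trans: "reach E S x y \<Longrightarrow> reach E S y z \<Longrightarrow> reach E S x z"
  by (auto simp: reach_def)

lemma reach_sym:
  assumes "\<And>a b. E a b \<Longrightarrow> E b a" "reach E S x y"
  shows "reach E S y x"
  using assms(2) unfolding reach_def
proof (induction rule: rtranclp_induct)
  case (step y z)
  then have "E z y \<and> z \<in> S \<and> y \<in> S" using assms(1) by blast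
  then show ?case using step.IH by (rule converse_rtranclp_into_rtranclp)
qed simp

lemma reach_closed:
  assumes "reach E S x y" "x \<in> C" "\<And>a b. a \<in> C \<Longrightarrow> E a b \<Longrightarrow> a \<in> S \<Longrightarrow> b \<in> S \<Longrightarrow> b \<in> C"
  shows "y \<in> C"
  using assms(1) unfolding reach_def
  by (induction rule: rtranclp_induct) (use assms in auto)

lemma walk_reach:
  assumes "walk_in E S p"
  shows "reach E S (hd p) (last p)"
proof -
  have "reach E S (p ! 0) (p ! i)" if "i < length p" for i
    using that
  proof (induction i)
    case (Suc i)
    then have "E (p ! i) (p ! Suc i)" "p ! i \<in> S" "p ! Suc i \<in> S"
      using assms by (auto simp: walk_in_def)
    then show ?case using Suc reach_edge reach_trans by (metis Suc_lessD)
  qed (rule reach_refl)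
  from this[of "length p - 1"] show ?thesis
    using assms by (simp add: walk_in_def hd_conv_nth last_conv_nth)
qed

lemma component_subset: "x \<in> S \<Longrightarrow> component E S x \<subseteq> S"
  using reach_closed[of E S x _ S] unfolding component_def by blast

lemma component_edge:
  "x \<in> S \<Longrightarrow> a \<in> component E S x \<Longrightarrow> b \<in> S \<Longrightarrow> E a b \<Longrightarrow> b \<in> component E S x"
  using component_subset[of x S E] reach_edge[of E a b S] reach_trans[of E S x a b]
  unfolding component_def by blast

lemma component_eq:
  assumes "\<And>a b. E a b \<Longrightarrow> E b a" "z \<in> component E S x" "z \<in> component E S y"
  shows "component E S x = component E S y"
proof -
  have "reach E S x z" "reach E S y z" using assms(2,3) by (simp_all add: component_def)
  moreover from this have "reach E S z x" "reach E S z y"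
    using reach_sym[of E S, OF assms(1)] by simp_all
  ultimately have "reach E S x y" "reach E S y x" by (meson reach_trans)+
  then have "reach E S x w \<longleftrightarrow> reach E S y w" for w by (meson reach_trans)
  then show ?thesis by (simp add: component_def)
qed

text \<open>A walk in \<open>S\<close> from \<open>x\<close> stays in the component of
  \<open>x\<close>, so it survives in every \<open>C\<close> containing that component. This gives
  reachability inside \<open>insert u D\<close>, which the induction hypothesis asks for.\<close>

lemma component_reach:
  assumes "x \<in> S" "component E S x \<subseteq> C" "y \<in> component E S x"
  shows "reach E C x y"
proof -
  have "y \<in> {y \<in> component E S x. reach E C x y}"
  proof (rule reach_closed)
    show "reach E S x y" using assms by (simp add: component_def)
    show "x \<in> {y \<in> component E S x. reach E C x y}" by (simp add: component_def reach_refl)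
    fix a b assume a: "a \<in> {y \<in> component E S x. reach E C x y}" and "E a b" "a \<in> S" "b \<in> S"
    then have "b \<in> component E S x" using component_edge[OF assms(1), of a E b] by blast
    then show "b \<in> {y \<in> component E S x. reach E C x y}"
      using a \<open>E a b\<close> assms(2) reach_edge[of E a b C] reach_trans[of E C x a b] by blast
  qed
  then show ?thesis by simp
qed

section \<open>The induction on the number of vertices in triangle-free graphs\<close>

locale triangle_free_graph =
  fixes E :: "'a \<Rightarrow> 'a \<Rightarrow> bool"
  assumes sym: "E a b \<Longrightarrow> E b a"
    and irrefl: "\<not> E a a"
    and no_triangle: "\<not> (E a b \<and> E b c \<and> E a c)"
begin

text \<open>Triangle-freeness makes the neighbours of \<open>v\<close> independent, so together with
  \<open>v\<close> they form an induced star.\<close>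

lemma neighbours_bound:
  assumes "finite V" "v \<in> V"
    and no_tree: "\<And>T. T \<subseteq> V \<Longrightarrow> rooted_tree E v T \<Longrightarrow> card T \<le> k"
  shows "card {u \<in> V. E v u} + 1 \<le> k"
proof -
  have "rooted_tree E v (insert v {u \<in> V. E v u})"
    by (rule rooted_tree_star) (use assms(1) irrefl[of v] no_triangle[of v] in auto)
  then show ?thesis using no_tree[of "insert v {u \<in> V. E v u}"] assms irrefl by simp
qed

text \<open>Starting from the star on \<open>insert v I\<close>, the trees are attached one
  \<open>D\<close> at a time. Of everything built so far only \<open>rt D\<close> can be adjacent to
  \<open>D\<close>, so \<open>rooted_tree_glue\<close> applies at \<open>rt D\<close> and the sizes
  add up.\<close>

lemma rooted_tree_glue_components:
  assumes "finite I" "\<forall>i\<in>I. E v i"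
    and "finite Q" "\<forall>D\<in>Q. rt D \<in> I \<and> B D \<subseteq> D \<and> rooted_tree E (rt D) (insert (rt D) (B D))"
    and "\<forall>D\<in>Q. finite D \<and> v \<notin> D \<and> I \<inter> D = {} \<and> (\<forall>x\<in>D. \<not> E v x)"
    and "\<forall>D\<in>Q. \<forall>i\<in>I. \<forall>x\<in>D. E i x \<longrightarrow> i = rt D"
    and "\<forall>C\<in>Q. \<forall>D\<in>Q. C \<noteq> D \<longrightarrow> C \<inter> D = {} \<and> (\<forall>x\<in>C. \<forall>y\<in>D. \<not> E x y)"
  shows "rooted_tree E v (insert v I \<union> \<Union> (B ` Q)) \<and>
    card (insert v I \<union> \<Union> (B ` Q)) = 1 + card I + (\<Sum>D\<in>Q. card (B D))"
  using assms(3-)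
proof (induction rule: finite_induct)
  case empty
  have "v \<notin> I" using assms(2) irrefl[of v] by blast
  moreover have "rooted_tree E v (insert v I)"
  proof (rule rooted_tree_star[of I v E, OF \<open>finite I\<close> \<open>v \<notin> I\<close> assms(2)])
    show "\<forall>x\<in>I. \<forall>y\<in>I. \<not> E x y" using assms(2) no_triangle[of v] by blast
  qed
  ultimately show ?case using \<open>finite I\<close> by simp
next
  case (insert D Q)
  let ?S = "insert v I \<union> \<Union> (B ` Q)"
  have IH: "rooted_tree E v ?S" "card ?S = 1 + card I + (\<Sum>D\<in>Q. card (B D))"
    using insert by simp_all
  have D: "rt D \<in> I" "B D \<subseteq> D" "rooted_tree E (rt D) (insert (rt D) (B D))"
    "finite D" "v \<notin> D" "I \<inter> D = {}" "\<forall>x\<in>D. \<not> E v x" "\<forall>i\<in>I. \<forall>x\<in>D. E i x \<longrightarrow> i = rt D"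
    using insert.prems by simp_all
  have other: "B C \<inter> D = {} \<and> (\<forall>x\<in>B C. \<forall>y\<in>D. \<not> E x y)" if "C \<in> Q" for C
  proof -
    have "C \<noteq> D" using that insert.hyps by blast
    then have "C \<inter> D = {} \<and> (\<forall>x\<in>C. \<forall>y\<in>D. \<not> E x y)" using that insert.prems(4) by blast
    moreover have "B C \<subseteq> C" using that insert.prems(1) by blast
    ultimately show ?thesis by blast
  qed
  have disj: "?S \<inter> B D = {}" using D other by blast
  have "rooted_tree E v (?S \<union> insert (rt D) (B D))"
  proof (rule rooted_tree_glue[OF D(3) IH(1)])
    show "rt D \<in> ?S" using D by blast
    show "?S \<inter> insert (rt D) (B D) \<subseteq> {rt D}" using disj by blast
    show "\<forall>a\<in>?S - {rt D}. \<forall>b\<in>insert (rt D) (B D) - {rt D}. \<not> E a b"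
      using D other by blast
  qed
  moreover have "?S \<union> insert (rt D) (B D) = insert v I \<union> \<Union> (B ` insert D Q)"
    using D by blast
  moreover have "card (?S \<union> B D) = card ?S + card (B D)"
    using rooted_tree_finite[OF IH(1)] finite_subset[OF D(2,4)] disj by (rule card_Un_disjoint)
  moreover have "?S \<union> B D = insert v I \<union> \<Union> (B ` insert D Q)" by blast
  ultimately show ?case using IH(2) insert.hyps by simp
qed

text \<open>The induction hypothesis is a premise so that this step serves twice: within the
  induction for \<open>large_connected_has_rooted_tree\<close>, and afterwards, with that lemma
  plugged in, for \<open>nonneighbours_bound\<close>.\<close>

lemma nonneighbours_bound_step:
  assumes IH: "\<And>S u j. card S < card V \<Longrightarrow> finite S \<Longrightarrow> u \<in> S \<Longrightarrow> (\<forall>x\<in>S. reach E S u x) \<Longrightarrow>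
      j * (j - 1) < 2 * card (S - {u}) \<Longrightarrow> \<exists>T\<subseteq>S. rooted_tree E u T \<and> card T = j + 1"
    and "finite V" "v \<in> V" and conn: "\<forall>x\<in>V. reach E V v x"
    and no_tree: "\<And>T. T \<subseteq> V \<Longrightarrow> rooted_tree E v T \<Longrightarrow> card T \<le> k"
  shows "2 * card (V - insert v {u \<in> V. E v u}) \<le> (k - 1) * (k - 2)"
proof -
  define N where "N = {u \<in> V. E v u}"
  define R where "R = V - insert v N"
  define F where "F = component E R ` R"
  define touches where "touches D u \<longleftrightarrow> (\<exists>x\<in>D. E u x)" for D u
  \<comment> \<open>For nonempty \<open>D\<close>, minimality gives
    \<open>t D * (t D - 1) < 2 * card D \<le> t D * (t D + 1)\<close>: the left half triggers the
    induction hypothesis, the right half serves the final count.\<close>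
  define t where "t D = (LEAST n. 2 * card D \<le> n * (n + 1))" for D :: "'a set"
  have finR: "finite R" and finN: "finite N" using \<open>finite V\<close> by (auto simp: R_def N_def)
  have finF: "finite F" using finR by (simp add: F_def)
  have FR: "D \<subseteq> R" if "D \<in> F" for D
    using that component_subset[of _ R E] unfolding F_def by blast
  have finD: "finite D" if "D \<in> F" for D by (rule finite_subset[OF FR[OF that] finR])
  have disj: "C \<inter> D = {}" if "C \<in> F" "D \<in> F" "C \<noteq> D" for C D
  proof (rule ccontr)
    assume "C \<inter> D \<noteq> {}"
    then obtain z where "z \<in> C" "z \<in> D" by blast
    then show False using that component_eq[of E z R, OF sym] by (auto simp: F_def)
  qed
  have closed: "y \<in> D" if "D \<in> F" "x \<in> D" "y \<in> R" "E x y" for D x y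
    using that component_edge[of _ R x E y] unfolding F_def by blast
  have noedge: "\<not> E x y" if "C \<in> F" "D \<in> F" "C \<noteq> D" "x \<in> C" "y \<in> D" for C D x y
    using that closed[of C x y] FR[of D] disj[of C D] by blast
  \<comment> \<open>Otherwise the complement of \<open>D\<close> contains \<open>v\<close> and is
    closed under edges in \<open>V\<close>, so \<open>D\<close> could not be reached from
    \<open>v\<close>.\<close>
  have cover: "\<exists>u\<in>N. touches D u" if D: "D \<in> F" for D
  proof (rule ccontr)
    assume nt: "\<not> ?thesis"
    obtain x where x: "x \<in> R" "D = component E R x" using D unfolding F_def by blast
    have "x \<in> D" by (simp add: x component_def reach_refl)
    have "x \<in> - D"
    proof (rule reach_closed)
      show "reach E V v x" using conn x by (simp add: R_def)
      show "v \<in> - D" using FR[OF that] by (auto simp: R_def)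
      fix a b assume ab: "a \<in> - D" "E a b" "a \<in> V" "b \<in> V"
      show "b \<in> - D"
      proof
        assume "b \<in> D"
        then have "b \<in> R" using FR that by blast
        then have "a \<noteq> v" using ab by (auto simp: R_def N_def)
        moreover have "a \<notin> N" using nt ab \<open>b \<in> D\<close> unfolding touches_def by blast
        ultimately have "a \<in> R" using ab by (simp add: R_def)
        then show False using closed[OF that \<open>b \<in> D\<close>] ab sym by blast
      qed
    qed
    then show False using \<open>x \<in> D\<close> by blast
  qed
  have t_upper: "2 * card D \<le> t D * (t D + 1)" for D :: "'a set"
    unfolding t_def by (rule LeastI[of _ "2 * card D"]) simp
  have trees: "\<exists>B\<subseteq>D. rooted_tree E u (insert u B) \<and> card B = t D"
    if D: "D \<in> F" "u \<in> N" "touches D u" for D u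
  proof -
    obtain d where d: "d \<in> D" "E u d" using D unfolding touches_def by blast
    have "u \<notin> D" using FR[OF that(1)] that by (auto simp: R_def)
    have "d \<in> R" using FR that(1) d by blast
    obtain x where x: "D = component E R x" using D(1) unfolding F_def by blast
    have "d \<in> component E R d" by (simp add: component_def reach_refl)
    then have "component E R d = D" using component_eq[of E d R, OF sym] d x by blast
    \<comment> \<open>Positivity keeps \<open>t D - 1\<close> from being truncated, so that it is a
      smaller candidate to which minimality of \<open>t D\<close> applies.\<close>
    have "t D > 0" using t_upper[of D] d finD[OF that(1)] by (cases "t D = 0") auto
    then have lower: "t D * (t D - 1) < 2 * card D"
      using not_less_Least[of "t D - 1" "\<lambda>n. 2 * card D \<le> n * (n + 1)"]
      unfolding t_def[symmetric] by (simp add: mult.commute)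
    \<comment> \<open>Induction hypothesis with root \<open>u\<close> and \<open>j = t D\<close>;
      the set \<open>insert u D\<close> is smaller than \<open>V\<close> because it omits
      \<open>v\<close>.\<close>
    have "\<exists>T\<subseteq>insert u D. rooted_tree E u T \<and> card T = t D + 1"
    proof (rule IH)
      have "insert u D \<subseteq> V - {v}" using FR[OF that(1)] that irrefl by (auto simp: R_def N_def)
      then have "card (insert u D) \<le> card (V - {v})" using \<open>finite V\<close> by (intro card_mono) auto
      then show "card (insert u D) < card V"
        using card_Diff1_less[OF \<open>finite V\<close> \<open>v \<in> V\<close>] by linarith
      show "finite (insert u D)" using finD that by blast
      show "t D * (t D - 1) < 2 * card (insert u D - {u})" using lower \<open>u \<notin> D\<close> by simp
      have "reach E (insert u D) u d" using d by (intro reach_edge) auto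
      moreover have "reach E (insert u D) d x" if "x \<in> D" for x
        using component_reach[OF \<open>d \<in> R\<close>, of E "insert u D" x] \<open>component E R d = D\<close> that by blast
      ultimately show "\<forall>x\<in>insert u D. reach E (insert u D) u x"
        using reach_refl reach_trans by (metis insert_iff)
    qed simp
    then obtain T where T: "T \<subseteq> insert u D" "rooted_tree E u T" "card T = t D + 1" by blast
    have "u \<in> T" using T rooted_tree_root by fast
    then have "insert u (T - {u}) = T" "card (T - {u}) = t D" using T by auto
    then show ?thesis using T by (intro exI[of _ "T - {u}"]) auto
  qed
  \<comment> \<open>The glued tree consists of \<open>v\<close>, \<open>I\<close> and
    \<open>t D\<close> vertices from each \<open>D\<close> touched exactly once. It has at most
    \<open>k\<close> vertices, and discounting \<open>v\<close> leaves \<open>k - 1\<close>.\<close>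
  have unique: "card I + (\<Sum>D | D \<in> F \<and> (\<exists>!i. i \<in> I \<and> touches D i). t D) \<le> k - 1"
    if I: "I \<subseteq> N" for I
  proof -
    \<comment> \<open>A \<open>D\<close> touched by several members of \<open>I\<close> is left out,
      since a second edge into its tree could close a cycle.\<close>
    define Q where "Q = {D \<in> F. \<exists>!i. i \<in> I \<and> touches D i}"
    define rt where "rt D = (THE i. i \<in> I \<and> touches D i)" for D
    have rt: "rt D \<in> I" "touches D (rt D)" if "D \<in> Q" for D
      using that theI'[of "\<lambda>i. i \<in> I \<and> touches D i"] by (auto simp: rt_def Q_def)
    have rt_eq: "i = rt D" if "D \<in> Q" "i \<in> I" "touches D i" for D i
      using that rt[OF that(1)] unfolding Q_def by blast
    have QF: "Q \<subseteq> F" by (auto simp: Q_def)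
    have "\<exists>B\<subseteq>D. rooted_tree E (rt D) (insert (rt D) B) \<and> card B = t D" if "D \<in> Q" for D
      using trees[of D "rt D"] rt[OF that] I QF that by blast
    then have "\<forall>D\<in>Q. \<exists>B. B \<subseteq> D \<and> rooted_tree E (rt D) (insert (rt D) B) \<and> card B = t D"
      by blast
    from bchoice[OF this] obtain B where
      B: "\<forall>D\<in>Q. B D \<subseteq> D \<and> rooted_tree E (rt D) (insert (rt D) (B D)) \<and> card (B D) = t D"
      by blast
    let ?T = "insert v I \<union> \<Union> (B ` Q)"
    have "rooted_tree E v ?T \<and> card ?T = 1 + card I + (\<Sum>D\<in>Q. card (B D))"
    proof (rule rooted_tree_glue_components)
      show "finite I" using I finN finite_subset by blast
      show "\<forall>i\<in>I. E v i" using I by (auto simp: N_def)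
      show "finite Q" using finF QF finite_subset by blast
      show "\<forall>D\<in>Q. rt D \<in> I \<and> B D \<subseteq> D \<and> rooted_tree E (rt D) (insert (rt D) (B D))"
        using B rt by blast
      show "\<forall>D\<in>Q. finite D \<and> v \<notin> D \<and> I \<inter> D = {} \<and> (\<forall>x\<in>D. \<not> E v x)"
        using QF FR finD I unfolding R_def N_def by blast
      show "\<forall>D\<in>Q. \<forall>i\<in>I. \<forall>x\<in>D. E i x \<longrightarrow> i = rt D"
        using rt_eq unfolding touches_def by blast
      show "\<forall>C\<in>Q. \<forall>D\<in>Q. C \<noteq> D \<longrightarrow> C \<inter> D = {} \<and> (\<forall>x\<in>C. \<forall>y\<in>D. \<not> E x y)"
      proof (intro ballI impI)
        fix C D assume CD: "C \<in> Q" "D \<in> Q" "C \<noteq> D"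
        then have "C \<in> F" "D \<in> F" using QF by auto
        then show "C \<inter> D = {} \<and> (\<forall>x\<in>C. \<forall>y\<in>D. \<not> E x y)"
          using disj[of C D] noedge[of C D] CD by simp
      qed
    qed
    moreover have "?T \<subseteq> V"
    proof -
      have "B D \<subseteq> V" if "D \<in> Q" for D using B FR[of D] QF that by (auto simp: R_def)
      moreover have "I \<subseteq> V" using I by (auto simp: N_def)
      ultimately show ?thesis using \<open>v \<in> V\<close> by blast
    qed
    ultimately have "1 + card I + (\<Sum>D\<in>Q. card (B D)) \<le> k" using no_tree[of ?T] by simp
    moreover have "(\<Sum>D\<in>Q. card (B D)) = (\<Sum>D\<in>Q. t D)" using B by simp
    ultimately show ?thesis unfolding Q_def by simp
  qed
  have "R = \<Union> F"
  proof
    show "R \<subseteq> \<Union> F" unfolding F_def by (auto simp: component_def intro: reach_refl)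
    show "\<Union> F \<subseteq> R" using FR by blast
  qed
  then have "card R = (\<Sum>D\<in>F. card D)"
    using card_Union_disjoint[of F] disj finD by (auto simp: pairwise_def disjnt_def)
  then have "2 * card R = (\<Sum>D\<in>F. 2 * card D)" by (simp add: sum_distrib_left)
  also have "\<dots> \<le> (\<Sum>D\<in>F. t D * (t D + 1))" by (intro sum_mono t_upper)
  also have "\<dots> \<le> (k - 1) * (k - 1 - 1)"
    using unique_cover_quadratic_bound[OF finF finN, of touches t "k - 1"] cover unique by simp
  finally show ?thesis by (simp add: R_def N_def numeral_2_eq_2)
qed

text \<open>Otherwise pruning bounds every tree rooted at \<open>u\<close> by \<open>k\<close>
  vertices, which leaves at most \<open>k - 1\<close> neighbours and
  \<open>(k - 1) * (k - 2) / 2\<close> further vertices, together \<open>k * (k - 1) / 2\<close>.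
  The root and \<open>k\<close> vary in the induction, as each component brings its own.\<close>

lemma large_connected_has_rooted_tree:
  assumes "finite S" "u \<in> S" "\<forall>x\<in>S. reach E S u x" "k * (k - 1) < 2 * card (S - {u})"
  shows "\<exists>T\<subseteq>S. rooted_tree E u T \<and> card T = k + 1"
  using assms
proof (induction "card S" arbitrary: S u k rule: less_induct)
  case less
  show ?case
  proof (rule ccontr)
    assume none: "\<not> ?thesis"
    have no_tree: "card T \<le> k" if T: "T \<subseteq> S" "rooted_tree E u T" for T
    proof (rule ccontr)
      assume "\<not> card T \<le> k"
      then obtain T' where "T' \<subseteq> T" "rooted_tree E u T'" "card T' = k + 1"
        using rooted_tree_subtree[OF T(2), of "k + 1"] by auto
      then show False using none that by blast
    qed
    let ?N = "{x \<in> S. E u x}"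
    have N: "card ?N + 1 \<le> k"
      by (rule neighbours_bound[OF less.prems(1,2) no_tree])
    have R: "2 * card (S - insert u ?N) \<le> (k - 1) * (k - 2)"
      by (rule nonneighbours_bound_step[OF less.hyps less.prems(1-3) no_tree])
    have "S - {u} = ?N \<union> (S - insert u ?N)" using irrefl by auto
    then have "card (S - {u}) \<le> card ?N + card (S - insert u ?N)" by (metis card_Un_le)
    then have "2 * card (S - {u}) \<le> 2 * (k - 1) + (k - 1) * (k - 2)" using N R by linarith
    also have "\<dots> \<le> k * (k - 1)"
    proof (cases "k \<ge> 2")
      case True
      then obtain m where "k = m + 2" using le_Suc_ex by (metis add.commute)
      then show ?thesis by (simp add: algebra_simps)
    next
      \<comment> \<open>Truncated subtraction makes both sides 0 here.\<close>
      case False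
      then have "k = 0 \<or> k = 1" by linarith
      then show ?thesis by auto
    qed
    finally show False using less.prems(4) by simp
  qed
qed

lemma nonneighbours_bound:
  assumes "finite V" "v \<in> V" "\<forall>x\<in>V. reach E V v x"
    and "\<And>T. T \<subseteq> V \<Longrightarrow> rooted_tree E v T \<Longrightarrow> card T \<le> k"
  shows "2 * card (V - insert v {u \<in> V. E v u}) \<le> (k - 1) * (k - 2)"
  by (rule nonneighbours_bound_step[OF _ assms]) (rule large_connected_has_rooted_tree)

end

theorem theorem2:
  fixes V :: "'a set" and E :: "'a \<Rightarrow> 'a \<Rightarrow> bool" and v :: 'a and k :: nat
  assumes "k \<ge> 1"
    and "simple_graph V E"
    and "connected_on E V"
    and "triangle_free E"
    and "v \<in> V"
    and "\<not> (\<exists>S. S \<subseteq> V \<and> v \<in> S \<and> card S = k + 1 \<and> induced_tree E S)"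
  shows "real (card (V - closed_nbhd V E v)) \<le> (real k - 2) * (real k - 1) / 2"
proof -
  interpret triangle_free_graph E
    by unfold_locales (use assms(2,4) in \<open>unfold simple_graph_def triangle_free_def, blast+\<close>)
  \<comment> \<open>The assumption excludes only trees on exactly \<open>k + 1\<close> vertices; a
    larger rooted tree could be pruned to one of these that still contains \<open>v\<close>.\<close>
  have no_tree: "card T \<le> k" if T: "T \<subseteq> V" "rooted_tree E v T" for T
  proof (rule ccontr)
    assume "\<not> card T \<le> k"
    then obtain S where "S \<subseteq> T" "rooted_tree E v S" "card S = k + 1"
      using rooted_tree_subtree[OF T(2), of "k + 1"] by auto
    then show False
      using assms(6) that rooted_tree_root rooted_tree_induced_tree[of E, OF sym irrefl]
      by (metis subset_trans)
  qed
  have conn: "\<forall>x\<in>V. reach E V v x"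
    using assms(3,5) walk_reach unfolding connected_on_def by metis
  have "2 * card (V - closed_nbhd V E v) \<le> (k - 1) * (k - 2)"
    unfolding closed_nbhd_def
    by (rule nonneighbours_bound) (use assms conn no_tree in \<open>auto simp: simple_graph_def\<close>)
  then have "2 * real (card (V - closed_nbhd V E v)) \<le> real ((k - 1) * (k - 2))"
    by (metis of_nat_le_iff of_nat_mult of_nat_numeral)
  \<comment> \<open>At \<open>k = 1\<close> the truncated \<open>k - 2\<close> differs from the real
    one, but the factor \<open>k - 1\<close> vanishes.\<close>
  also have "\<dots> = (real k - 1) * (real k - 2)"
    using \<open>k \<ge> 1\<close> by (cases "k = 1") (auto simp: of_nat_diff)
  finally show ?thesis by (simp add: mult.commute)
qed

end
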